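(* Let $S$ be a $p\times p$ positive semidefinite matrix with $\dim(\mathcal{N}(S))=m_0$, where $\mathcal{N}(S)=\{v\in\mathbb{R}^p: Sv=0\}$, and with strictly positive diagonal entries. Suppose that $$\liminf_{x\to\infty}\frac{\mathrm{pen}_D(x)}{\log x}=c_D,\qquad \liminf_{|x|\to\infty}\frac{\mathrm{pen}(x)}{\log|x|}=c_O.$$ If $c_D+c_O>m_0$, then the penalised likelihood estimate $\hat\Theta_{\mathrm{Pen}}$ exists.
   Context: Fix an integer $p\ge 1$. All matrices are real symmetric $p\times p$; $\Theta=(\theta_{ij})\succ 0$ means $\Theta$ is positive definite. The diagonal penalty $\mathrm{pen}_D:(0,\infty)\to\mathbb{R}$ is non-negative, non-decreasing and continuous. The off-diagonal penalty $\mathrm{pen}:\mathbb{R}\to\mathbb{R}$ is non-negative, symmetric around $0$, non-decreasing in $|x|$ and continuous. Define $$\mathrm{Pen}(\Theta)=\sum_{i=1}^p \mathrm{pen}_D(\theta_{ii})+\sum_{i<j}\mathrm{pen}(\theta_{ij}),\qquad l_{\mathrm{Pen}}(\Theta\mid S)=\log\det\Theta-\mathrm{tr}(S\Theta)-\mathrm{Pen}(\Theta),\quad \Theta\succ 0.$$ The penalised likelihood estimate is $\hat\Theta_{\mathrm{Pen}}=\mathrm{argmax}_{\Theta\succ 0}\, l_{\mathrm{Pen}}(\Theta\mid S)$; it is said to exist if the supremum of $l_{\mathrm{Pen}}(\cdot\mid S)$ over positive definite $\Theta$ is finite and attained. *)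

theory Defs
  imports "HOL-Analysis.Analysis"
begin

definition positive_definite :: "real^'n^'n \<Rightarrow> bool" where
  "positive_definite A \<longleftrightarrow> transpose A = A \<and> (\<forall>v. v \<noteq> 0 \<longrightarrow> v \<bullet> (A *v v) > 0)"

definition positive_semidefinite :: "real^'n^'n \<Rightarrow> bool" where
  "positive_semidefinite A \<longleftrightarrow> transpose A = A \<and> (\<forall>v. v \<bullet> (A *v v) \<ge> 0)"

definition null_space :: "real^'n^'n \<Rightarrow> (real^'n) set" where
  "null_space A = {v. A *v v = 0}"

text \<open>The linear order on the index type only serves to select each off-diagonal pair once.\<close>

definition Pen ::
  "(real \<Rightarrow> real) \<Rightarrow> (real \<Rightarrow> real) \<Rightarrow>
     real^'n::{finite,linorder}^'n::{finite,linorder} \<Rightarrow> real" where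
  "Pen pen\<^sub>D pen \<Theta> =
     (\<Sum>i\<in>UNIV. pen\<^sub>D (\<Theta> $ i $ i)) + (\<Sum>(i, j)\<in>{(i, j). i < j}. pen (\<Theta> $ i $ j))"

definition l_Pen ::
  "(real \<Rightarrow> real) \<Rightarrow> (real \<Rightarrow> real) \<Rightarrow>
     real^'n::{finite,linorder}^'n::{finite,linorder} \<Rightarrow>
     real^'n::{finite,linorder}^'n::{finite,linorder} \<Rightarrow> real" where
  "l_Pen pen\<^sub>D pen S \<Theta> = ln (det \<Theta>) - trace (S ** \<Theta>) - Pen pen\<^sub>D pen \<Theta>"

text \<open>The supremum over the positive definite matrices is finite (the set of values is nonempty,
  so \<^const>\<open>bdd_above\<close> says exactly this) and attained; a maximiser need not be unique.\<close>

definition penalised_estimate_exists ::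
  "(real \<Rightarrow> real) \<Rightarrow> (real \<Rightarrow> real) \<Rightarrow> real^'n::{finite,linorder}^'n::{finite,linorder} \<Rightarrow> bool" where
  "penalised_estimate_exists pen\<^sub>D pen S \<longleftrightarrow>
     bdd_above (l_Pen pen\<^sub>D pen S ` {\<Theta>. positive_definite \<Theta>}) \<and>
     (\<exists>\<Theta>hat. positive_definite \<Theta>hat \<and>
        l_Pen pen\<^sub>D pen S \<Theta>hat = (SUP \<Theta>\<in>{\<Theta>. positive_definite \<Theta>}. l_Pen pen\<^sub>D pen S \<Theta>))"

end

theory Submission
  imports Defs "HOL-Real_Asymp.Real_Asymp"
begin

text \<open>
  Let \<open>M\<close> be the largest diagonal entry of \<open>\<Theta>\<close>, which bounds all entries, and let \<open>t\<close> be the trace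
  of \<open>S\<Theta>\<close>. Factor \<open>S = R\<^sup>T R\<close>. In a basis consisting of \<open>p - m\<^sub>0\<close> rows of \<open>R\<close> and \<open>m\<^sub>0\<close> further
  vectors, the quadratic form of \<open>\<Theta>\<close> is at most \<open>t\<close> on the former and \<open>O(M)\<close> on the latter, so
  Hadamard's inequality (up to a constant) gives \<open>det \<Theta> \<le> C t\<^bsup>p - m\<^sub>0\<^esup> M\<^bsup>m\<^sub>0\<^esup>\<close>. Hence the objective is at most
  \<open>C' + m\<^sub>0 log M - t/2 - Pen \<Theta>\<close>. Because the diagonal of \<open>S\<close> is positive, either
  \<open>t \<ge> c M\<close>, or some off-diagonal entry exceeds \<open>\<delta> M\<close> and the penalties contribute more than
  \<open>m\<^sub>0 log M\<close>. So superlevel sets are bounded; on them \<open>det \<Theta>\<close> is bounded away from 0, and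
  compactness yields a maximiser.
\<close>

section \<open>Gram factorisation of semidefinite matrices\<close>

text \<open>Moving along one coordinate axis makes the form a quadratic polynomial in
  \<open>c\<close>. A vanishing leading coefficient forces the row to vanish; a positive one allows
  the minimisation behind elimination.\<close>

lemma quadratic_form_shift:
  fixes A :: "real^'n^'n"
  assumes "transpose A = A"
  shows "(v + c *\<^sub>R axis i 1) \<bullet> (A *v (v + c *\<^sub>R axis i 1)) =
    v \<bullet> (A *v v) + 2 * c * (A *v v) $ i + c\<^sup>2 * A $ i $ i"
proof -
  have 1: "v \<bullet> (A *v axis i 1) = (A *v v) $ i"
    by (metis assms dot_lmul_matrix inner_axis inner_real_def mult.right_neutral transpose_matrix_vector)
  have 2: "axis i 1 \<bullet> (A *v w) = (A *v w) $ i" for w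
    by (simp add: inner_axis')
  have 3: "(A *v axis i 1) $ i = A $ i $ i"
    by (simp add: matrix_vector_mult_basis column_def)
  show ?thesis
    by (simp add: matrix_vector_right_distrib matrix_vector_mult_scaleR inner_add_left inner_add_right
        1 2 3 power2_eq_square algebra_simps)
qed

lemma positive_semidefinite_diag:
  fixes A :: "real^'n^'n"
  assumes "positive_semidefinite A"
  shows "0 \<le> A $ i $ i"
  using assms quadratic_form_shift[of A 0 1 i]
  unfolding positive_semidefinite_def by (metis (no_types, lifting) add.left_neutral inner_zero_left
      matrix_vector_mult_0_right mult.left_neutral mult_zero_right power_one scaleR_one zero_index)

lemma symmetric_entry:
  assumes "transpose A = A"
  shows "A $ i $ j = A $ j $ i"
  using assms by (metis transpose_def vec_lambda_beta)

text \<open>With a zero diagonal entry, the form at \<open>axis j 1 + c *\<^sub>R axis i 1\<close>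
  is affine in \<open>c\<close> with slope twice \<open>A $ i $ j\<close>. An affine function that
  is bounded below has slope zero.\<close>

lemma positive_semidefinite_zero_row:
  fixes A :: "real^'n^'n"
  assumes A: "positive_semidefinite A" and 0: "A $ i $ i = 0"
  shows "A $ i = 0"
proof (rule ccontr)
  assume "A $ i \<noteq> 0"
  then obtain j where j: "A $ i $ j \<noteq> 0" by (auto simp: vec_eq_iff)
  have sym: "transpose A = A" using A by (simp add: positive_semidefinite_def)
  \<comment> \<open>Solves \<open>A $ j $ j + 2 * c * A $ i $ j = - 1\<close>.\<close>
  define c where "c = - (A $ j $ j + 1) / (2 * A $ i $ j)"
  have "axis j 1 \<bullet> (A *v axis j 1) = A $ j $ j" "(A *v axis j 1) $ i = A $ i $ j"
    by (simp_all add: inner_axis' matrix_vector_mult_basis column_def)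
  then have "(axis j 1 + c *\<^sub>R axis i 1) \<bullet> (A *v (axis j 1 + c *\<^sub>R axis i 1)) = - 1"
    using j by (simp add: quadratic_form_shift[OF sym] 0 c_def field_simps)
  then show False using A unfolding positive_semidefinite_def
    by (metis neg_0_le_iff_le not_one_le_zero)
qed

text \<open>One step of symmetric Gaussian elimination. The value of the new form at
  \<open>v\<close> is the minimum over \<open>c\<close> of the old form at
  \<open>v + c *\<^sub>R axis i 1\<close>, hence nonnegative.\<close>

lemma positive_semidefinite_eliminate:
  fixes A :: "real^'n^'n"
  assumes A: "positive_semidefinite A" and pos: "0 < A $ i $ i"
  shows "positive_semidefinite (\<chi> a b. A $ a $ b - A $ i $ a * A $ i $ b / A $ i $ i)"
    (is "positive_semidefinite ?A'")
proof -
  have sym: "transpose A = A" using A by (simp add: positive_semidefinite_def)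
  have "transpose ?A' = ?A'"
    using symmetric_entry[OF sym] by (simp add: transpose_def vec_eq_iff mult.commute)
  moreover have "0 \<le> v \<bullet> (?A' *v v)" for v
  proof -
    \<comment> \<open>The minimiser of the quadratic polynomial in \<open>c\<close>.\<close>
    define c where "c = - ((A *v v) $ i / A $ i $ i)"
    have "?A' *v v = A *v v - ((A *v v) $ i / A $ i $ i) *\<^sub>R A $ i"
      by (simp add: vec_eq_iff matrix_vector_mult_def algebra_simps sum_subtractf
          sum_distrib_left sum_divide_distrib)
    moreover have "v \<bullet> A $ i = (A *v v) $ i"
      by (simp add: matrix_vector_mul_component inner_commute)
    ultimately have "v \<bullet> (?A' *v v) = v \<bullet> (A *v v) - ((A *v v) $ i)\<^sup>2 / A $ i $ i"
      by (simp add: inner_diff_right power2_eq_square)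
    also have "\<dots> = (v + c *\<^sub>R axis i 1) \<bullet> (A *v (v + c *\<^sub>R axis i 1))"
      unfolding quadratic_form_shift[OF sym] c_def using pos
      by (simp add: power2_eq_square field_simps)
    also have "\<dots> \<ge> 0" using A by (simp add: positive_semidefinite_def)
    finally show ?thesis .
  qed
  ultimately show ?thesis by (simp add: positive_semidefinite_def)
qed

text \<open>Cholesky by induction on a set \<open>J\<close> containing the indices of all nonzero
  rows. Each pivot contributes one row of \<open>R\<close>; zero rows keep \<open>R\<close>
  square.\<close>

lemma positive_semidefinite_factor:
  fixes A :: "real^'n^'n"
  assumes "positive_semidefinite A"
  obtains R :: "real^'n^'n" where "A = transpose R ** R"
proof -
  have "\<exists>R::real^'n^'n. (\<forall>k. k \<notin> J \<longrightarrow> R $ k = 0) \<and> (\<forall>a b. A $ a $ b = (\<Sum>k\<in>UNIV. R $ k $ a * R $ k $ b))"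
    if "finite J" "positive_semidefinite A" "\<forall>k. k \<notin> J \<longrightarrow> A $ k = 0" for J and A :: "real^'n^'n"
    using that
  proof (induction J arbitrary: A rule: finite_induct)
    case empty
    then show ?case by (intro exI[of _ 0]) simp
  next
    case (insert i J)
    show ?case
    proof (cases "A $ i $ i = 0")
      case True
      then have "A $ i = 0" using positive_semidefinite_zero_row insert.prems by blast
      then have "\<forall>k. k \<notin> J \<longrightarrow> A $ k = 0" using insert.prems(2) by auto
      from insert.IH[OF insert.prems(1) this] show ?thesis by auto
    next
      case False
      then have pos: "0 < A $ i $ i"
        using positive_semidefinite_diag[OF insert.prems(1), of i] by simp
      have sym: "A $ a $ b = A $ b $ a" for a b
        using insert.prems by (simp add: positive_semidefinite_def symmetric_entry)
      let ?A' = "\<chi> a b. A $ a $ b - A $ i $ a * A $ i $ b / A $ i $ i"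
      \<comment> \<open>Row \<open>i\<close> is cleared by the elimination. A row outside
        \<open>insert i J\<close> was zero, so by symmetry its entry in row \<open>i\<close> is zero
        as well and nothing is subtracted from it.\<close>
      have "?A' $ k = 0" if "k \<notin> J" for k
        using that insert.prems(2) pos sym[of i k] by (cases "k = i") (auto simp: vec_eq_iff)
      then obtain R :: "real^'n^'n" where R0: "\<And>k. k \<notin> J \<Longrightarrow> R $ k = 0"
        and R: "\<And>a b. ?A' $ a $ b = (\<Sum>k\<in>UNIV. R $ k $ a * R $ k $ b)"
        using insert.IH[OF positive_semidefinite_eliminate[OF insert.prems(1) pos]] by blast
      \<comment> \<open>Row \<open>i\<close> of \<open>R\<close> is zero because \<open>i\<close> is
        not in \<open>J\<close>, so overwriting it only adds the rank-one term removed by the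
        elimination.\<close>
      define Q where "Q = (\<chi> k. if k = i then (1 / sqrt (A $ i $ i)) *\<^sub>R A $ i else R $ k)"
      have "A $ a $ b = (\<Sum>k\<in>UNIV. Q $ k $ a * Q $ k $ b)" for a b
      proof -
        have "(\<Sum>k\<in>UNIV. Q $ k $ a * Q $ k $ b) =
            Q $ i $ a * Q $ i $ b + (\<Sum>k\<in>UNIV - {i}. Q $ k $ a * Q $ k $ b)"
          by (simp add: sum.remove)
        also have "(\<Sum>k\<in>UNIV - {i}. Q $ k $ a * Q $ k $ b) = (\<Sum>k\<in>UNIV - {i}. R $ k $ a * R $ k $ b)"
          by (intro sum.cong) (auto simp: Q_def)
        also have "\<dots> = (\<Sum>k\<in>UNIV. R $ k $ a * R $ k $ b)"
          using R0[OF insert.hyps(2)] by (simp add: sum.remove[of UNIV i])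
        also have "\<dots> = A $ a $ b - A $ i $ a * A $ i $ b / A $ i $ i"
          using R[of a b] by simp
        also have "Q $ i $ a * Q $ i $ b = A $ i $ a * A $ i $ b / A $ i $ i"
          using pos by (simp add: Q_def)
        finally show ?thesis by simp
      qed
      moreover have "\<forall>k. k \<notin> insert i J \<longrightarrow> Q $ k = 0" using R0 by (simp add: Q_def)
      ultimately show ?thesis by blast
    qed
  qed
  from this[of UNIV A] assms obtain R :: "real^'n^'n"
    where "\<And>a b. A $ a $ b = (\<Sum>k\<in>UNIV. R $ k $ a * R $ k $ b)" by auto
  then have "A = transpose R ** R"
    by (simp add: vec_eq_iff matrix_matrix_mult_def transpose_def)
  then show ?thesis by (rule that)
qed

lemma quadratic_form_factor:
  fixes R :: "real^'n^'m"
  shows "v \<bullet> ((transpose R ** R) *v v) = (norm (R *v v))\<^sup>2"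
  by (metis dot_lmul_matrix inner_commute matrix_vector_mul_assoc power2_norm_eq_inner transpose_matrix_vector)

lemma positive_semidefinite_gram: "positive_semidefinite (transpose R ** R)"
  unfolding positive_semidefinite_def quadratic_form_factor
  by (simp add: matrix_transpose_mul)

lemma null_space_gram:
  fixes R :: "real^'n^'n"
  shows "null_space (transpose R ** R) = null_space R"
proof -
  have "(transpose R ** R) *v v = 0 \<longleftrightarrow> R *v v = 0" for v
  proof
    assume "(transpose R ** R) *v v = 0"
    then have "(norm (R *v v))\<^sup>2 = 0"
      by (metis quadratic_form_factor inner_zero_right)
    then show "R *v v = 0" by simp
  qed (simp flip: matrix_vector_mul_assoc)
  then show ?thesis by (simp add: null_space_def)
qed

section \<open>Definiteness, determinants and entry bounds\<close>

lemma positive_definite_imp_semidefinite: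
  "positive_definite A \<Longrightarrow> positive_semidefinite A"
  unfolding positive_definite_def positive_semidefinite_def
  by (metis inner_zero_left order_less_imp_le order_refl)

text \<open>For a Gram factor \<open>R\<close>, \<open>det A\<close> is the square of
  \<open>det R\<close>, and both sides amount to \<open>R\<close> being injective. This replaces an
  open condition by a closed one plus a determinant bound, the form suited to compactness.\<close>

lemma positive_definite_iff_det:
  fixes A :: "real^'n^'n"
  shows "positive_definite A \<longleftrightarrow> positive_semidefinite A \<and> 0 < det A"
proof (intro iffI conjI; (elim conjE)?)
  assume A: "positive_definite A"
  then show psd: "positive_semidefinite A" by (rule positive_definite_imp_semidefinite)
  then obtain R :: "real^'n^'n" where R: "A = transpose R ** R" by (rule positive_semidefinite_factor)
  have "inj ((*v) A)"
    using A unfolding positive_definite_def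
    by (metis inner_zero_right less_irrefl matrix_left_invertible_injective matrix_left_invertible_ker)
  then have "det A \<noteq> 0"
    by (metis invertible_det_nz invertible_left_inverse matrix_left_invertible_injective)
  moreover have "det A = (det R)\<^sup>2" by (simp add: R det_mul power2_eq_square)
  ultimately show "0 < det A" by simp
next
  assume psd: "positive_semidefinite A" and d: "0 < det A"
  obtain R :: "real^'n^'n" where R: "A = transpose R ** R"
    using psd by (rule positive_semidefinite_factor)
  have "0 < v \<bullet> (A *v v)" if "v \<noteq> 0" for v
  proof -
    have "det R \<noteq> 0" using d by (auto simp: R det_mul)
    then have "R *v v \<noteq> 0" using that
      by (metis invertible_det_nz invertible_left_inverse matrix_left_invertible_ker)
    then show ?thesis unfolding R quadratic_form_factor by simp
  qed
  then show "positive_definite A" using psd by (simp add: positive_definite_def positive_semidefinite_def)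
qed

text \<open>The entries are inner products of columns of a Gram factor, so this is
  Cauchy-Schwarz.\<close>

lemma positive_semidefinite_entry_le:
  fixes A :: "real^'n^'n"
  assumes "positive_semidefinite A"
  shows "\<bar>A $ i $ j\<bar> \<le> sqrt (A $ i $ i) * sqrt (A $ j $ j)"
proof -
  obtain R :: "real^'n^'n" where R: "A = transpose R ** R"
    using assms by (rule positive_semidefinite_factor)
  show ?thesis
    using Cauchy_Schwarz_ineq2[of "column i R" "column j R"]
    by (simp add: R matrix_mult_transpose_dot_column norm_eq_sqrt_inner)
qed

text \<open>A weak Hadamard inequality: the factor \<open>fact\<close> is the number of terms in the Leibniz formula
  and spares the sharp version.\<close>

lemma positive_semidefinite_det_le:
  fixes A :: "real^'n^'n"
  assumes "positive_semidefinite A"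
  shows "det A \<le> fact CARD('n) * (\<Prod>i\<in>UNIV. A $ i $ i)"
proof -
  note nn = positive_semidefinite_diag[OF assms]
  have "of_int (sign p) * (\<Prod>i\<in>UNIV. A $ i $ p i) \<le> (\<Prod>i\<in>UNIV. A $ i $ i)"
    if p: "p permutes UNIV" for p :: "'n \<Rightarrow> 'n"
  proof -
    have "of_int (sign p) * (\<Prod>i\<in>UNIV. A $ i $ p i) \<le> \<bar>of_int (sign p) * (\<Prod>i\<in>UNIV. A $ i $ p i)\<bar>"
      by simp
    also have "\<dots> = (\<Prod>i\<in>UNIV. \<bar>A $ i $ p i\<bar>)"
      by (simp add: abs_mult abs_prod sign_def)
    also have "\<dots> \<le> (\<Prod>i\<in>UNIV. sqrt (A $ i $ i) * sqrt (A $ p i $ p i))"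
      using positive_semidefinite_entry_le[OF assms] by (intro prod_mono) auto
    also have "\<dots> = (\<Prod>i\<in>UNIV. sqrt (A $ i $ i)) * (\<Prod>i\<in>UNIV. sqrt (A $ p i $ p i))"
      by (rule prod.distrib)
    \<comment> \<open>A permutation meets every row and every column once, so each diagonal entry
      collects two square roots.\<close>
    also have "(\<Prod>i\<in>UNIV. sqrt (A $ p i $ p i)) = (\<Prod>i\<in>UNIV. sqrt (A $ i $ i))"
      using prod.permute[OF p, of "\<lambda>i. sqrt (A $ i $ i)"] by (simp add: o_def)
    also have "(\<Prod>i\<in>UNIV. sqrt (A $ i $ i)) * (\<Prod>i\<in>UNIV. sqrt (A $ i $ i)) = (\<Prod>i\<in>UNIV. A $ i $ i)"
      using nn by (simp flip: prod.distrib)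
    finally show ?thesis .
  qed
  then have "det A \<le> (\<Sum>p | p permutes (UNIV::'n set). (\<Prod>i\<in>UNIV. A $ i $ i))"
    unfolding det_def by (intro sum_mono) auto
  then show ?thesis by (simp add: card_permutations)
qed

section \<open>Determinant bound through the trace\<close>

lemma congruence_entry:
  fixes P :: "real^'n^'m"
  shows "(P ** A ** transpose P) $ i $ j = P $ i \<bullet> (A *v P $ j)"
proof -
  have "(P ** A ** transpose P) $ i $ j = (\<Sum>k\<in>UNIV. (\<Sum>l\<in>UNIV. P $ i $ l * A $ l $ k) * P $ j $ k)"
    by (simp add: matrix_matrix_mult_def transpose_def)
  also have "\<dots> = (\<Sum>l\<in>UNIV. \<Sum>k\<in>UNIV. P $ i $ l * A $ l $ k * P $ j $ k)"
    by (subst sum.swap) (simp add: sum_distrib_right)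
  also have "\<dots> = P $ i \<bullet> (A *v P $ j)"
    by (simp add: inner_vec_def matrix_vector_mult_def sum_distrib_left mult_ac)
  finally show ?thesis .
qed

lemma positive_semidefinite_congruence:
  fixes P :: "real^'n^'n"
  assumes "positive_semidefinite A"
  shows "positive_semidefinite (P ** A ** transpose P)"
proof -
  obtain R :: "real^'n^'n" where R: "A = transpose R ** R"
    using assms by (rule positive_semidefinite_factor)
  have "P ** A ** transpose P = transpose (R ** transpose P) ** (R ** transpose P)"
    by (simp add: R matrix_transpose_mul matrix_mul_assoc)
  then show ?thesis by (metis positive_semidefinite_gram)
qed

text \<open>Cyclicity of the trace. For semidefinite \<open>A\<close> the summands are nonnegative,
  so the trace controls the quadratic form of \<open>A\<close> on each row of
  \<open>R\<close>.\<close>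

lemma trace_gram_mult:
  fixes R A :: "real^'n^'n"
  shows "trace (transpose R ** R ** A) = (\<Sum>k\<in>UNIV. R $ k \<bullet> (A *v R $ k))"
proof -
  have "trace (transpose R ** R ** A) = trace (R ** A ** transpose R)"
    by (metis matrix_mul_assoc trace_mul_sym)
  then show ?thesis by (simp add: trace_def congruence_entry)
qed

lemma quadratic_form_le_trace:
  fixes R A :: "real^'n^'n"
  assumes "positive_semidefinite A"
  shows "R $ k \<bullet> (A *v R $ k) \<le> trace (transpose R ** R ** A)"
  using assms member_le_sum[of k UNIV "\<lambda>k. R $ k \<bullet> (A *v R $ k)"]
  by (simp add: positive_semidefinite_def trace_gram_mult)

lemma trace_mult_nonneg:
  fixes S A :: "real^'n^'n"
  assumes "positive_semidefinite S" "positive_semidefinite A"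
  shows "0 \<le> trace (S ** A)"
proof -
  obtain R :: "real^'n^'n" where "S = transpose R ** R"
    using assms(1) by (rule positive_semidefinite_factor)
  then show ?thesis
    using assms(2) by (simp add: trace_gram_mult positive_semidefinite_def sum_nonneg)
qed

lemma quadratic_form_le_entries:
  fixes A :: "real^'n^'n"
  assumes "\<And>i j. \<bar>A $ i $ j\<bar> \<le> M"
  shows "v \<bullet> (A *v v) \<le> (\<Sum>i\<in>UNIV. \<bar>v $ i\<bar>)\<^sup>2 * M"
proof -
  have "v \<bullet> (A *v v) = (\<Sum>i\<in>UNIV. \<Sum>j\<in>UNIV. v $ i * v $ j * A $ i $ j)"
    by (simp add: inner_vec_def matrix_vector_mult_def sum_distrib_left mult_ac)
  also have "\<dots> \<le> (\<Sum>i\<in>UNIV. \<Sum>j\<in>UNIV. \<bar>v $ i\<bar> * \<bar>v $ j\<bar> * M)"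
  proof (intro sum_mono)
    fix i j
    have "v $ i * v $ j * A $ i $ j \<le> \<bar>v $ i * v $ j * A $ i $ j\<bar>" by simp
    also have "\<dots> \<le> \<bar>v $ i\<bar> * \<bar>v $ j\<bar> * M"
      using assms by (simp add: abs_mult mult_left_mono)
    finally show "v $ i * v $ j * A $ i $ j \<le> \<bar>v $ i\<bar> * \<bar>v $ j\<bar> * M" .
  qed
  also have "\<dots> = (\<Sum>i\<in>UNIV. \<bar>v $ i\<bar>)\<^sup>2 * M"
    by (simp add: power2_eq_square sum_product sum_distrib_right sum_distrib_left mult_ac)
  finally show ?thesis .
qed

text \<open>Rank-nullity: the null space is the orthogonal complement of the row space.\<close>

lemma dim_null_space:
  fixes R :: "real^'n^'n"
  shows "dim (null_space R) + rank R = CARD('n)"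
proof -
  have "null_space R = {y \<in> UNIV. \<forall>x \<in> span (rows R). orthogonal x y}"
  proof (intro equalityI subsetI)
    fix v assume "v \<in> null_space R"
    then show "v \<in> {y \<in> UNIV. \<forall>x \<in> span (rows R). orthogonal x y}"
      using orthogonal_nullspace_rowspace[of R v] by (auto simp: null_space_def orthogonal_commute)
  next
    fix v assume "v \<in> {y \<in> UNIV. \<forall>x \<in> span (rows R). orthogonal x y}"
    then have "R $ i \<bullet> v = 0" for i
      by (auto simp: orthogonal_def rows_def row_def intro!: span_base)
    then show "v \<in> null_space R"
      by (simp add: null_space_def vec_eq_iff matrix_vector_mul_component)
  qed
  then show ?thesis
    using dim_subspace_orthogonal_to_vectors[of "span (rows R)" UNIV]
    by (simp add: row_rank_def)
qed

text \<open>Congruence by the matrix \<open>P\<close> of basis vectors multiplies the determinant by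
  the square of \<open>det P\<close> and puts the values of the form on the diagonal, where the weak
  Hadamard inequality applies. \<open>C\<close> depends on \<open>S\<close> and the chosen basis
  only.\<close>

lemma det_le_trace_power:
  fixes S :: "real^'n^'n"
  assumes S: "positive_semidefinite S"
  obtains C where "0 \<le> C"
    "\<And>A M. \<lbrakk>positive_semidefinite A; \<And>i j. \<bar>A $ i $ j\<bar> \<le> M\<rbrakk> \<Longrightarrow>
       det A \<le> C * trace (S ** A) ^ rank S * M ^ dim (null_space S)"
proof -
  obtain R :: "real^'n^'n" where R: "S = transpose R ** R"
    using S by (rule positive_semidefinite_factor)
  have dimR: "dim (null_space S) = dim (null_space R)" by (simp add: R null_space_gram)
  then have rank: "rank R = rank S" using dim_null_space[of S] dim_null_space[of R] by simp
  \<comment> \<open>Taking the basis of the row space among the rows themselves gives the trace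
    bound for each of its vectors.\<close>
  obtain B where B: "B \<subseteq> rows R" "independent B" "card B = rank S"
    by (metis basis_exists rank row_rank_def)
  obtain B' where B': "B \<subseteq> B'" "independent B'" "UNIV \<subseteq> span B'"
    using maximal_independent_subset_extend[of B UNIV] B by auto
  have finB': "finite B'" using B'(2) by (rule independent_imp_finite)
  have cardB': "card B' = CARD('n)"
    using B' dim_eq_card[of B' UNIV] by (simp add: top.extremum_unique)
  obtain f where f: "bij_betw f (UNIV::'n set) B'"
    using finite_same_card_bij[of "UNIV::'n set" B'] finB' cardB' by auto
  define P :: "real^'n^'n" where "P = (\<chi> i. f i)"
  have "rows P = B'"
    using f by (auto simp: P_def rows_def row_def bij_betw_def)
  then have "rank P = CARD('n)"
    using B' cardB' by (simp add: row_rank_def dim_eq_card_independent)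
  then have detP: "det P \<noteq> 0" by (simp add: det_eq_0_rank)
  have card_diff: "card (B' - B) = dim (null_space S)"
    using B B' finB' cardB' dim_null_space[of S] by (simp add: card_Diff_subset finite_subset)
  \<comment> \<open>The coefficients of \<open>M\<close> in the entrywise bound, multiplied over the
    vectors added to \<open>B\<close>.\<close>
  define K where "K = (\<Prod>b\<in>B' - B. (\<Sum>i\<in>UNIV. \<bar>b $ i\<bar>)\<^sup>2)"
  define C where "C = fact CARD('n) * K / (det P)\<^sup>2"
  have K: "0 \<le> K" unfolding K_def by (intro prod_nonneg) auto
  have "det A \<le> C * trace (S ** A) ^ rank S * M ^ dim (null_space S)"
    if A: "positive_semidefinite A" and M: "\<And>i j. \<bar>A $ i $ j\<bar> \<le> M" for A M
  proof -
    have nn: "0 \<le> b \<bullet> (A *v b)" for b using A by (simp add: positive_semidefinite_def)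
    have "b \<bullet> (A *v b) \<le> trace (S ** A)" if "b \<in> B" for b
    proof -
      have "b \<in> rows R" using B that by blast
      then obtain k where "b = R $ k" by (auto simp: rows_def row_def)
      then show ?thesis using quadratic_form_le_trace[OF A, of R k] by (simp add: R)
    qed
    then have 1: "(\<Prod>b\<in>B. b \<bullet> (A *v b)) \<le> trace (S ** A) ^ rank S"
      using prod_mono[of B "\<lambda>b. b \<bullet> (A *v b)" "\<lambda>_. trace (S ** A)"] nn B(3) by simp
    have 2: "(\<Prod>b\<in>B' - B. b \<bullet> (A *v b)) \<le> K * M ^ dim (null_space S)"
    proof -
      have "(\<Prod>b\<in>B' - B. b \<bullet> (A *v b)) \<le> (\<Prod>b\<in>B' - B. (\<Sum>i\<in>UNIV. \<bar>b $ i\<bar>)\<^sup>2 * M)"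
        using nn quadratic_form_le_entries[OF M] by (intro prod_mono) auto
      then show ?thesis by (simp add: prod.distrib K_def card_diff)
    qed
    have "(det P)\<^sup>2 * det A = det (P ** A ** transpose P)"
      by (simp add: det_mul power2_eq_square)
    also have "\<dots> \<le> fact CARD('n) * (\<Prod>i\<in>UNIV. P $ i \<bullet> (A *v P $ i))"
      using positive_semidefinite_det_le[OF positive_semidefinite_congruence[OF A, of P]]
      by (simp add: congruence_entry)
    also have "(\<Prod>i\<in>UNIV. P $ i \<bullet> (A *v P $ i)) = (\<Prod>b\<in>B'. b \<bullet> (A *v b))"
      using prod.reindex_bij_betw[OF f, of "\<lambda>b. b \<bullet> (A *v b)"] by (simp add: P_def)
    also have "\<dots> = (\<Prod>b\<in>B' - B. b \<bullet> (A *v b)) * (\<Prod>b\<in>B. b \<bullet> (A *v b))"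
      using finB' B' by (simp add: prod.subset_diff)
    also have "\<dots> \<le> (K * M ^ dim (null_space S)) * trace (S ** A) ^ rank S"
      using 1 2 nn by (intro mult_mono) (auto intro: prod_nonneg order_trans[OF prod_nonneg 2])
    finally have "(det P)\<^sup>2 * det A \<le> fact CARD('n) * (K * M ^ dim (null_space S) * trace (S ** A) ^ rank S)"
      by simp
    then show ?thesis using detP by (simp add: C_def field_simps)
  qed
  moreover have "0 \<le> C" using K by (simp add: C_def)
  ultimately show ?thesis using that by blast
qed

section \<open>Bounds on the log-likelihood and the trace\<close>

text \<open>Absorbs the power of the trace at the price of half the trace; the other half remains
  available against \<open>ln M\<close>.\<close>

lemma power_le_exp_half:
  obtains C :: real where "0 < C" "\<And>t. 0 \<le> t \<Longrightarrow> t ^ a \<le> C * exp (t / 2)"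
proof (cases "a = 0")
  case True
  then show ?thesis by (intro that[of 1]) auto
next
  case False
  have "t ^ a \<le> (2 * real a) ^ a * exp (t / 2)" if "0 \<le> t" for t :: real
  proof -
    \<comment> \<open>The exponent is scaled so that the \<open>a\<close>-th power of the right side
      is \<open>exp (t / 2)\<close>.\<close>
    have "t / (2 * real a) \<le> exp (t / (2 * real a))"
      using exp_ge_add_one_self[of "t / (2 * real a)"] by linarith
    then have "(t / (2 * real a)) ^ a \<le> exp (t / (2 * real a)) ^ a"
      using that by (intro power_mono) auto
    also have "\<dots> = exp (t / 2)"
      using False by (simp flip: exp_of_nat_mult)
    finally show ?thesis
      using False by (simp add: power_divide field_simps)
  qed
  then show ?thesis using False by (intro that[of "(2 * real a) ^ a"]) auto
qed

lemma positive_semidefinite_entry_le_max: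
  fixes A :: "real^'n^'n"
  assumes A: "positive_semidefinite A" and M: "\<And>i. A $ i $ i \<le> M"
  shows "\<bar>A $ i $ j\<bar> \<le> M"
proof -
  have "0 \<le> M" using positive_semidefinite_diag[OF A] M order_trans by blast
  have "\<bar>A $ i $ j\<bar> \<le> sqrt (A $ i $ i) * sqrt (A $ j $ j)"
    by (rule positive_semidefinite_entry_le[OF A])
  also have "\<dots> \<le> sqrt M * sqrt M"
    using M \<open>0 \<le> M\<close> positive_semidefinite_diag[OF A] by (intro mult_mono) auto
  finally show ?thesis using \<open>0 \<le> M\<close> by simp
qed

lemma positive_definite_diag:
  fixes A :: "real^'n^'n"
  assumes "positive_definite A"
  shows "0 < A $ i $ i"
proof -
  have "axis i 1 \<bullet> (A *v axis i 1) = A $ i $ i"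
    by (simp add: inner_axis' matrix_vector_mult_basis column_def)
  then show ?thesis
    using assms unfolding positive_definite_def by (metis axis_eq_0_iff zero_neq_one)
qed

lemma ln_det_minus_trace_le:
  fixes S :: "real^'n^'n"
  assumes S: "positive_semidefinite S"
  shows "\<exists>C. \<forall>A M. positive_definite A \<longrightarrow> (\<forall>i. A $ i $ i \<le> M) \<longrightarrow>
    ln (det A) - trace (S ** A) \<le> C + dim (null_space S) * ln M - trace (S ** A) / 2"
proof -
  obtain C where C: "0 \<le> C"
    "\<And>A M. \<lbrakk>positive_semidefinite A; \<And>i j. \<bar>A $ i $ j\<bar> \<le> M\<rbrakk> \<Longrightarrow>
       det A \<le> C * trace (S ** A) ^ rank S * M ^ dim (null_space S)"
    using det_le_trace_power[OF S] by blast
  obtain K :: real where K: "0 < K" "\<And>t. 0 \<le> t \<Longrightarrow> t ^ rank S \<le> K * exp (t / 2)"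
    using power_le_exp_half[of "rank S"] by blast
  \<comment> \<open>\<open>C\<close> may be 0; \<open>C + 1\<close> keeps the argument of
    \<open>ln\<close> positive.\<close>
  have "ln (det A) - trace (S ** A) \<le> ln ((C + 1) * K) + dim (null_space S) * ln M - trace (S ** A) / 2"
    if A: "positive_definite A" and M: "\<And>i. A $ i $ i \<le> M" for A M
  proof -
    let ?t = "trace (S ** A)" and ?m = "dim (null_space S)"
    have psd: "positive_semidefinite A" and det: "0 < det A"
      using A by (auto simp: positive_definite_iff_det)
    have "0 < M" using positive_definite_diag[OF A] M less_le_trans by blast
    have t: "0 \<le> ?t" using S psd by (rule trace_mult_nonneg)
    have "det A \<le> C * ?t ^ rank S * M ^ ?m"
      using C(2)[OF psd positive_semidefinite_entry_le_max[OF psd M]] .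
    also have "\<dots> \<le> (C + 1) * (K * exp (?t / 2)) * M ^ ?m"
      using C(1) K(2)[OF t] t \<open>0 < M\<close> by (intro mult_mono) (auto intro!: mult_nonneg_nonneg less_imp_le[OF K(1)])
    finally have "ln (det A) \<le> ln ((C + 1) * (K * exp (?t / 2)) * M ^ ?m)"
      using det by (simp add: ln_mono)
    also have "\<dots> = ln ((C + 1) * K) + ?t / 2 + ?m * ln M"
      using C(1) K(1) \<open>0 < M\<close> by (simp add: ln_mult ln_realpow)
    finally show ?thesis by simp
  qed
  then show ?thesis by blast
qed

text \<open>Diagonal products are nonnegative and the \<open>k\<close>-th is at least
  \<open>s\<close> times \<open>A $ k $ k\<close>, while small off-diagonal entries can cancel only
  half of that. Later \<open>k\<close> is the index of the largest diagonal entry.\<close>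

lemma trace_ge_of_small_off_diagonal:
  fixes S :: "real^'n^'n"
  assumes S: "\<And>i. 0 < S $ i $ i"
  shows "\<exists>\<delta>>0. \<exists>c>0. \<forall>A k. positive_semidefinite A \<longrightarrow>
    (\<forall>i j. i \<noteq> j \<longrightarrow> \<bar>A $ i $ j\<bar> \<le> \<delta> * A $ k $ k) \<longrightarrow> c * A $ k $ k \<le> trace (S ** A)"
proof -
  define s where "s = Min (range (\<lambda>i. S $ i $ i))"
  define T where "T = (\<Sum>i\<in>UNIV. \<Sum>j\<in>UNIV. \<bar>S $ i $ j\<bar>)"
  have s: "0 < s" "s \<le> S $ i $ i" for i
    unfolding s_def using S by auto
  have row: "0 < (\<Sum>j\<in>UNIV. \<bar>S $ i $ j\<bar>)" for i
    by (rule sum_pos2[of _ i]) (use S[of i] in auto)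
  have T: "0 < T" unfolding T_def by (intro sum_pos row) auto
  \<comment> \<open>Makes the total possible loss, \<open>T * \<delta>\<close> times
    \<open>A $ k $ k\<close>, equal to half the guaranteed gain.\<close>
  define \<delta> where "\<delta> = s / (2 * T)"
  have "s / 2 * A $ k $ k \<le> trace (S ** A)"
    if A: "positive_semidefinite A" and off: "\<And>i j. i \<noteq> j \<Longrightarrow> \<bar>A $ i $ j\<bar> \<le> \<delta> * A $ k $ k" for A k
  proof -
    let ?M = "A $ k $ k"
    have nn: "0 \<le> A $ i $ i" for i using A by (rule positive_semidefinite_diag)
    have "0 < \<delta>" using s(1) T by (simp add: \<delta>_def)
    \<comment> \<open>Of the diagonal only position \<open>(k, k)\<close> is kept. The loss is
      charged to diagonal positions too, so that the losses sum to exactly \<open>T\<close>.\<close>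
    have term_ge: "(if i = k \<and> j = k then S $ k $ k * ?M else 0) - \<bar>S $ i $ j\<bar> * (\<delta> * ?M) \<le> S $ i $ j * A $ j $ i"
      for i j
    proof (cases "i = j")
      case True
      have "0 \<le> \<bar>S $ i $ j\<bar> * (\<delta> * ?M)" using nn \<open>0 < \<delta>\<close> by simp
      moreover have "0 \<le> S $ j $ j * A $ j $ j" using nn S[of j] by simp
      ultimately show ?thesis using True by auto
    next
      case False
      have "- (S $ i $ j * A $ j $ i) \<le> \<bar>S $ i $ j\<bar> * \<bar>A $ j $ i\<bar>"
        by (metis abs_ge_minus_self abs_mult)
      also have "\<dots> \<le> \<bar>S $ i $ j\<bar> * (\<delta> * ?M)"
        using off[of j i] False by (intro mult_left_mono) auto
      finally show ?thesis using False by auto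
    qed
    have "(\<Sum>i\<in>UNIV. \<Sum>j\<in>UNIV. (if i = k \<and> j = k then S $ k $ k * ?M else 0)) =
        (\<Sum>i\<in>UNIV. if i = k then S $ k $ k * ?M else 0)"
      by (intro sum.cong) auto
    then have "S $ k $ k * ?M - T * (\<delta> * ?M) =
        (\<Sum>i\<in>UNIV. \<Sum>j\<in>UNIV. (if i = k \<and> j = k then S $ k $ k * ?M else 0) - \<bar>S $ i $ j\<bar> * (\<delta> * ?M))"
      by (simp add: sum_subtractf T_def sum_distrib_right)
    also have "\<dots> \<le> (\<Sum>i\<in>UNIV. \<Sum>j\<in>UNIV. S $ i $ j * A $ j $ i)"
      by (intro sum_mono term_ge)
    finally have "S $ k $ k * ?M - s / 2 * ?M \<le> (\<Sum>i\<in>UNIV. \<Sum>j\<in>UNIV. S $ i $ j * A $ j $ i)"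
      using T by (simp add: \<delta>_def)
    moreover have "s * ?M \<le> S $ k $ k * ?M" using s(2) nn by (rule mult_right_mono)
    ultimately show ?thesis by (simp add: trace_def matrix_matrix_mult_def)
  qed
  moreover have "0 < \<delta>" "0 < s / 2" using s(1) T by (simp_all add: \<delta>_def)
  ultimately show ?thesis by blast
qed

section \<open>Penalty bounds and growth exponents\<close>

lemma Pen_nonneg:
  fixes A :: "real^'n::{finite,linorder}^'n::{finite,linorder}"
  assumes "\<And>x. 0 < x \<Longrightarrow> 0 \<le> pen\<^sub>D x" "\<And>x. 0 \<le> pen x" "positive_definite A"
  shows "0 \<le> Pen pen\<^sub>D pen A"
  using assms by (auto simp: Pen_def intro!: add_nonneg_nonneg sum_nonneg positive_definite_diag)

lemma Pen_ge:
  fixes A :: "real^'n::{finite,linorder}^'n::{finite,linorder}"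
  assumes penD: "\<And>x. 0 < x \<Longrightarrow> 0 \<le> pen\<^sub>D x" and pen: "\<And>x. 0 \<le> pen x"
    and A: "positive_definite A" and "i \<noteq> j"
  shows "pen\<^sub>D (A $ k $ k) + pen (A $ i $ j) \<le> Pen pen\<^sub>D pen A"
proof -
  have less: "pen (A $ a $ b) \<le> (\<Sum>(i, j)\<in>{(i, j). i < j}. pen (A $ i $ j))" if "a < b" for a b
    using member_le_sum[of "(a, b)" "{(i, j). i < j}" "\<lambda>(i, j). pen (A $ i $ j)"] that pen by auto
  have "A $ i $ j = A $ j $ i"
    using A by (simp add: positive_definite_def symmetric_entry)
  then have "pen (A $ i $ j) \<le> (\<Sum>(i, j)\<in>{(i, j). i < j}. pen (A $ i $ j))"
    using less[of i j] less[of j i] \<open>i \<noteq> j\<close> by (metis linorder_neqE)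
  moreover have "pen\<^sub>D (A $ k $ k) \<le> (\<Sum>i\<in>UNIV. pen\<^sub>D (A $ i $ i))"
    using member_le_sum[of k UNIV "\<lambda>i. pen\<^sub>D (A $ i $ i)"] penD positive_definite_diag[OF A] by simp
  ultimately show ?thesis by (simp add: Pen_def)
qed

text \<open>The alternative \<open>d = 0\<close> covers a lower limit of 0, where no nonnegative
  \<open>d\<close> lies strictly below \<open>c\<close>; nonnegativity of \<open>g\<close> then
  suffices.\<close>

lemma eventually_ge_of_Liminf:
  fixes d :: real and g h :: "real \<Rightarrow> real"
  assumes "Liminf F (\<lambda>x. ereal (g x / h x)) = c" "d = 0 \<or> ereal d < c"
    and "eventually (\<lambda>x. 0 \<le> g x) F" "eventually (\<lambda>x. 0 < h x) F"
  shows "eventually (\<lambda>x. d * h x \<le> g x) F"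
proof (cases "d = 0")
  case True
  then show ?thesis using assms(3) by simp
next
  case False
  then have "eventually (\<lambda>x. ereal d < ereal (g x / h x)) F"
    using assms by (intro less_LiminfD) auto
  then show ?thesis using assms(4) by eventually_elim (simp add: field_simps)
qed

lemma Liminf_ratio_nonneg:
  fixes g h :: "real \<Rightarrow> real"
  assumes "eventually (\<lambda>x. 0 \<le> g x) F" "eventually (\<lambda>x. 0 < h x) F"
  shows "0 \<le> Liminf F (\<lambda>x. ereal (g x / h x))"
proof (rule Liminf_bounded)
  show "eventually (\<lambda>x. 0 \<le> ereal (g x / h x)) F"
    using assms by eventually_elim simp
qed

text \<open>The lower limits may be infinite, whereas the growth estimates use real exponents whose
  sum still exceeds \<open>m\<close>.\<close>

lemma real_exponents:
  fixes c c' :: ereal and m :: real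
  assumes "0 \<le> c" "0 \<le> c'" "ereal m < c + c'" "0 \<le> m"
  obtains d e :: real where "m < d + e" "d = 0 \<or> ereal d < c" "e = 0 \<or> ereal e < c'"
proof (cases c c' rule: ereal2_cases)
  case (real_real r s)
  \<comment> \<open>A third of the surplus: giving up \<open>g\<close> in each exponent leaves a sum
    of at least \<open>m + g\<close>. Truncation at 0 leads to the alternatives \<open>d = 0\<close>
    and \<open>e = 0\<close>.\<close>
  define g where "g = (r + s - m) / 3"
  have "0 < g" "0 \<le> r" "0 \<le> s" using assms real_real by (auto simp: g_def)
  then show ?thesis
    using real_real by (intro that[of "max 0 (r - g)" "max 0 (s - g)"]) (auto simp: g_def max_def field_simps)
next
  case real_PInf then show ?thesis using that[of 0 "m + 1"] by auto
next
  case PInf_real then show ?thesis using that[of "m + 1" 0] by auto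
next
  case PInf_PInf then show ?thesis using that[of "m + 1" 0] by auto
qed (use assms in auto)

section \<open>Superlevel sets: boundedness, continuity, compactness\<close>

lemma closed_positive_semidefinite: "closed {A :: real^'n^'n. positive_semidefinite A}"
  unfolding positive_semidefinite_def vec_eq_iff transpose_def inner_vec_def matrix_vector_mult_def
  by (auto intro!: closed_Collect_conj closed_Collect_all closed_Collect_eq closed_Collect_le
      continuous_intros)

lemma continuous_on_det: "continuous_on X (det :: real^'n^'n \<Rightarrow> real)"
  unfolding det_def by (intro continuous_intros)

lemma l_Pen_superlevel_diag_bounded:
  fixes S :: "real^'n::{finite,linorder}^'n::{finite,linorder}" and d e :: real
  assumes penD_nonneg: "\<And>x. 0 < x \<Longrightarrow> 0 \<le> pen\<^sub>D x"
    and pen_nonneg: "\<And>x. 0 \<le> pen x"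
    and pen_mono: "\<And>x y. \<bar>x\<bar> \<le> \<bar>y\<bar> \<Longrightarrow> pen x \<le> pen y"
    and S: "positive_semidefinite S" "\<And>i. 0 < S $ i $ i"
    and penD_ge: "eventually (\<lambda>x. d * ln x \<le> pen\<^sub>D x) at_top"
    and pen_ge: "eventually (\<lambda>x. e * ln x \<le> pen x) at_top"
    and growth: "dim (null_space S) < d + e"
  obtains B where "\<And>A i. \<lbrakk>positive_definite A; L \<le> l_Pen pen\<^sub>D pen S A\<rbrakk> \<Longrightarrow> A $ i $ i \<le> B"
proof -
  define m where "m = real (dim (null_space S))"
  obtain C where C: "\<forall>A M. positive_definite A \<longrightarrow> (\<forall>i. A $ i $ i \<le> M) \<longrightarrow>
      ln (det A) - trace (S ** A) \<le> C + m * ln M - trace (S ** A) / 2"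
    using ln_det_minus_trace_le[OF S(1)] unfolding m_def ..
  obtain \<delta> c where \<delta>: "0 < \<delta>" and c: "0 < c"
    and tr: "\<forall>A k. positive_semidefinite A \<longrightarrow>
      (\<forall>i j. i \<noteq> j \<longrightarrow> \<bar>A $ i $ j\<bar> \<le> \<delta> * A $ k $ k) \<longrightarrow> c * A $ k $ k \<le> trace (S ** A)"
    using trace_ge_of_small_off_diagonal[OF S(2)] by blast
  \<comment> \<open>The net decay rate: the penalties supply \<open>d + e\<close> multiples of
    \<open>ln M\<close> and the determinant takes back \<open>m\<close>.\<close>
  define g where "g = d + e - m"
  have g: "0 < g" using growth by (simp add: g_def m_def)
  have "filterlim (\<lambda>M. \<delta> * M) at_top at_top" using \<delta> by real_asymp
  then have "eventually (\<lambda>M. e * ln (\<delta> * M) \<le> pen (\<delta> * M)) at_top"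
    using pen_ge by (rule eventually_compose_filterlim[rotated])
  moreover have "eventually (\<lambda>M. C + m * ln M - c * M / 2 < L) at_top"
    using c by real_asymp
  moreover have "eventually (\<lambda>M. C - e * ln \<delta> - g * ln M < L) at_top"
    using g by real_asymp
  \<comment> \<open>The last two inequalities are the contradictions for the two cases below: trace
    of order \<open>M\<close>, or a large off-diagonal entry.\<close>
  ultimately have "eventually (\<lambda>M. 0 < M \<and> d * ln M \<le> pen\<^sub>D M \<and> e * ln (\<delta> * M) \<le> pen (\<delta> * M) \<and>
      C + m * ln M - c * M / 2 < L \<and> C - e * ln \<delta> - g * ln M < L) at_top"
    using penD_ge eventually_gt_at_top[of 0] by eventually_elim simp
  then obtain B where B: "\<And>M. B \<le> M \<Longrightarrow> 0 < M \<and> d * ln M \<le> pen\<^sub>D M \<and> e * ln (\<delta> * M) \<le> pen (\<delta> * M) \<and>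
      C + m * ln M - c * M / 2 < L \<and> C - e * ln \<delta> - g * ln M < L"
    unfolding eventually_at_top_linorder by blast
  have "A $ i $ i \<le> B" if A: "positive_definite A" and L: "L \<le> l_Pen pen\<^sub>D pen S A" for A i
  proof (rule ccontr)
    assume "\<not> A $ i $ i \<le> B"
    have "Max (range (\<lambda>i. A $ i $ i)) \<in> range (\<lambda>i. A $ i $ i)" by (intro Max_in) auto
    then obtain k where max: "Max (range (\<lambda>i. A $ i $ i)) = A $ k $ k" by (elim rangeE)
    have k: "A $ i $ i \<le> A $ k $ k" for i
      unfolding max[symmetric] by (intro Max_ge) auto
    define M where "M = A $ k $ k"
    have "B \<le> M" using k[of i] \<open>\<not> A $ i $ i \<le> B\<close> by (simp add: M_def)
    note M = B[OF this]
    have psd: "positive_semidefinite A" using A by (rule positive_definite_imp_semidefinite)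
    have t: "0 \<le> trace (S ** A)" using S(1) psd by (rule trace_mult_nonneg)
    have upper: "l_Pen pen\<^sub>D pen S A \<le> C + m * ln M - trace (S ** A) / 2 - Pen pen\<^sub>D pen A"
      using C[rule_format, OF A, of M] k by (simp add: l_Pen_def M_def)
    show False
    proof (cases "\<forall>i j. i \<noteq> j \<longrightarrow> \<bar>A $ i $ j\<bar> \<le> \<delta> * M")
      case True
      then have "c * M \<le> trace (S ** A)" using tr[rule_format, OF psd, of k] by (simp add: M_def)
      moreover have "0 \<le> Pen pen\<^sub>D pen A" using A by (intro Pen_nonneg penD_nonneg pen_nonneg)
      ultimately show False using upper L M by linarith
    next
      case False
      then obtain a b where ab: "a \<noteq> b" "\<delta> * M < \<bar>A $ a $ b\<bar>" by (auto simp: not_le)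
      \<comment> \<open>Monotonicity in the absolute value transfers the growth at
        \<open>\<delta> * M\<close> to the entry; the factor \<open>\<delta>\<close> costs only the
        constant \<open>e * ln \<delta>\<close>.\<close>
      have "pen (\<delta> * M) \<le> pen (A $ a $ b)"
        using ab(2) \<delta> M by (intro pen_mono) simp
      moreover have "pen\<^sub>D M + pen (A $ a $ b) \<le> Pen pen\<^sub>D pen A"
        unfolding M_def using A ab(1) by (intro Pen_ge penD_nonneg pen_nonneg)
      ultimately have "d * ln M + e * ln (\<delta> * M) \<le> Pen pen\<^sub>D pen A" using M by linarith
      moreover have "C + m * ln M - (d * ln M + e * ln (\<delta> * M)) = C - e * ln \<delta> - g * ln M"
        using \<delta> M by (simp add: ln_mult g_def algebra_simps)
      ultimately show False using upper L M t by linarith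
    qed
  qed
  then show ?thesis by (rule that)
qed

lemma continuous_on_l_Pen:
  fixes S :: "real^'n::{finite,linorder}^'n::{finite,linorder}"
  assumes penD_cont: "continuous_on {0<..} pen\<^sub>D" and pen_cont: "continuous_on UNIV pen"
  shows "continuous_on {A. positive_definite A} (l_Pen pen\<^sub>D pen S)"
proof -
  have "continuous_on {A. positive_definite A} (\<lambda>A. ln (det A))"
    by (intro continuous_on_ln continuous_on_det) (auto simp: positive_definite_iff_det)
  moreover have "continuous_on {A. positive_definite A} (\<lambda>A. trace (S ** A))"
    unfolding trace_def matrix_matrix_mult_def by (simp, intro continuous_intros)
  moreover have "continuous_on {A. positive_definite A} (Pen pen\<^sub>D pen)"
    unfolding Pen_def case_prod_beta
    by (intro continuous_on_add continuous_on_sum continuous_on_compose2[OF penD_cont]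
        continuous_on_compose2[OF pen_cont] continuous_intros) (auto intro: positive_definite_diag)
  ultimately show ?thesis
    unfolding l_Pen_def by (intro continuous_on_diff)
qed

text \<open>The diagonal bound controls all entries, hence the norm. For positive
  \<open>\<epsilon>\<close> the determinant condition keeps the set away from singular
  matrices.\<close>

lemma compact_semidefinite_det_ge:
  "compact {A :: real^'n^'n. positive_semidefinite A \<and> (\<forall>i. A $ i $ i \<le> B) \<and> \<epsilon> \<le> det A}"
    (is "compact ?K")
proof -
  have "norm A \<le> (\<Sum>i\<in>(UNIV::'n set). \<Sum>j\<in>(UNIV::'n set). B)" if "A \<in> ?K" for A
  proof -
    have "norm A \<le> (\<Sum>i\<in>UNIV. norm (A $ i))"
      unfolding norm_vec_def by (rule L2_set_le_sum) simp
    also have "\<dots> \<le> (\<Sum>i\<in>UNIV. \<Sum>j\<in>UNIV. \<bar>A $ i $ j\<bar>)"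
      by (intro sum_mono norm_le_l1_cart)
    also have "\<dots> \<le> (\<Sum>i\<in>(UNIV::'n set). \<Sum>j\<in>(UNIV::'n set). B)"
      using that by (intro sum_mono positive_semidefinite_entry_le_max) auto
    finally show ?thesis .
  qed
  then have "bounded ?K" by (rule boundedI)
  moreover have "closed ?K"
    by (intro closed_Collect_conj closed_positive_semidefinite closed_Collect_all closed_Collect_le
        continuous_on_det continuous_intros)
  ultimately show ?thesis by (simp add: compact_eq_bounded_closed)
qed

section \<open>Existence of a maximiser\<close>

theorem proposition8:
  fixes S :: "real^'n::{finite,linorder}^'n::{finite,linorder}"
    and pen\<^sub>D pen :: "real \<Rightarrow> real"
    and m\<^sub>0 :: nat
    and c\<^sub>D c\<^sub>O :: ereal
  assumes penD_nonneg: "\<And>x. 0 < x \<Longrightarrow> 0 \<le> pen\<^sub>D x"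
    and penD_mono: "mono_on {0<..} pen\<^sub>D"
    and penD_cont: "continuous_on {0<..} pen\<^sub>D"
    and pen_nonneg: "\<And>x. 0 \<le> pen x"
    and pen_sym: "\<And>x. pen (- x) = pen x"
    and pen_mono: "\<And>x y. \<bar>x\<bar> \<le> \<bar>y\<bar> \<Longrightarrow> pen x \<le> pen y"
    and pen_cont: "continuous_on UNIV pen"
    and S_psd: "positive_semidefinite S"
    and S_null: "dim (null_space S) = m\<^sub>0"
    and S_diag: "\<And>i. 0 < S $ i $ i"
    and penD_liminf: "Liminf at_top (\<lambda>x. ereal (pen\<^sub>D x / ln x)) = c\<^sub>D"
    and pen_liminf: "Liminf at_infinity (\<lambda>x. ereal (pen x / ln \<bar>x\<bar>)) = c\<^sub>O"
    and growth: "c\<^sub>D + c\<^sub>O > ereal (real m\<^sub>0)"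
  shows "penalised_estimate_exists pen\<^sub>D pen S"
proof -
  have penD_ev: "eventually (\<lambda>x. 0 \<le> pen\<^sub>D x) at_top"
    using eventually_gt_at_top[of 0] by eventually_elim (rule penD_nonneg)
  have ln_ev: "eventually (\<lambda>x::real. 0 < ln x) at_top"
    using eventually_gt_at_top[of 1] by eventually_elim simp
  have ln_abs_ev: "eventually (\<lambda>x::real. 0 < ln \<bar>x\<bar>) at_infinity"
    unfolding eventually_at_infinity by (intro exI[of _ 2]) simp
  have pen_ev: "eventually (\<lambda>x. 0 \<le> pen x) at_infinity" using pen_nonneg by simp
  have "0 \<le> c\<^sub>D" using Liminf_ratio_nonneg[OF penD_ev ln_ev] penD_liminf by simp
  moreover have "0 \<le> c\<^sub>O" using Liminf_ratio_nonneg[OF pen_ev ln_abs_ev] pen_liminf by simp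
  ultimately obtain d e :: real where de: "real m\<^sub>0 < d + e"
    and d: "d = 0 \<or> ereal d < c\<^sub>D" and e: "e = 0 \<or> ereal e < c\<^sub>O"
    using real_exponents[OF _ _ growth] by auto
  have penD_ge: "eventually (\<lambda>x. d * ln x \<le> pen\<^sub>D x) at_top"
    using penD_liminf d penD_ev ln_ev by (rule eventually_ge_of_Liminf)
  have "eventually (\<lambda>x. e * ln \<bar>x\<bar> \<le> pen x) at_infinity"
    using pen_liminf e pen_ev ln_abs_ev by (rule eventually_ge_of_Liminf)
  \<comment> \<open>Off-diagonal entries are compared through their absolute values, so the bound is
    read along the positive tail.\<close>
  then have "eventually (\<lambda>x. e * ln \<bar>x\<bar> \<le> pen x) at_top"
    using at_top_le_at_infinity by (rule filter_leD[rotated])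
  then have pen_ge: "eventually (\<lambda>x. e * ln x \<le> pen x) at_top"
    using eventually_gt_at_top[of 0] by eventually_elim simp

  let ?l = "l_Pen pen\<^sub>D pen S"
  \<comment> \<open>The identity matrix serves as reference point: a maximiser need only be sought
    where the objective reaches its value there.\<close>
  define L where "L = ?l (mat 1)"
  obtain B where B: "\<And>A i. \<lbrakk>positive_definite A; L \<le> ?l A\<rbrakk> \<Longrightarrow> A $ i $ i \<le> B"
    using l_Pen_superlevel_diag_bounded[OF penD_nonneg pen_nonneg pen_mono S_psd S_diag penD_ge pen_ge]
      de S_null by blast
  define K :: "(real^'n::{finite,linorder}^'n::{finite,linorder}) set"
    where "K = {A. positive_semidefinite A \<and> (\<forall>i. A $ i $ i \<le> B) \<and> exp L \<le> det A}"
  have K_pd: "positive_definite A" if "A \<in> K" for A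
    using that by (auto simp: K_def positive_definite_iff_det intro: less_le_trans[OF exp_gt_zero])
  \<comment> \<open>Trace and penalty are nonnegative, so \<open>ln (det A)\<close> is at least the
    objective; this yields the bound \<open>exp L\<close> in \<open>K\<close>.\<close>
  have in_K: "A \<in> K" if A: "positive_definite A" and L: "L \<le> ?l A" for A
  proof -
    have "positive_semidefinite A" "0 < det A" using A by (auto simp: positive_definite_iff_det)
    moreover have "0 \<le> Pen pen\<^sub>D pen A" using A by (intro Pen_nonneg penD_nonneg pen_nonneg)
    then have "L \<le> ln (det A)"
      using L trace_mult_nonneg[OF S_psd \<open>positive_semidefinite A\<close>] by (simp add: l_Pen_def)
    ultimately show ?thesis using B[OF A L] by (simp add: K_def ln_ge_iff)
  qed
  have one: "positive_definite (mat 1 :: real^'n::{finite,linorder}^'n::{finite,linorder})"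
    by (simp add: positive_definite_def)
  then have "mat 1 \<in> K" using in_K by (simp add: L_def)
  moreover have "compact K" unfolding K_def by (rule compact_semidefinite_det_ge)
  moreover have "continuous_on K ?l"
    using continuous_on_l_Pen[OF penD_cont pen_cont] by (rule continuous_on_subset) (use K_pd in auto)
  ultimately obtain A where A: "A \<in> K" "\<And>A'. A' \<in> K \<Longrightarrow> ?l A' \<le> ?l A"
    using continuous_attains_sup[of K ?l] by blast
  \<comment> \<open>Outside \<open>K\<close> the objective is below \<open>L\<close>, which the
    maximum over \<open>K\<close> reaches because the identity lies in \<open>K\<close>.\<close>
  have max: "?l A' \<le> ?l A" if "positive_definite A'" for A'
    using that in_K[of A'] A(2)[of A'] A(2)[OF \<open>mat 1 \<in> K\<close>] by (fastforce simp: L_def)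
  have "(SUP A\<in>{A. positive_definite A}. ?l A) = ?l A"
    using K_pd[OF A(1)] max by (intro cSup_eq_maximum) auto
  moreover have "bdd_above (?l ` {A. positive_definite A})"
    using max by (intro bdd_aboveI2) auto
  ultimately show ?thesis
    unfolding penalised_estimate_exists_def using K_pd[OF A(1)] by auto
qed

end
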